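(* Let $(\omega,\psi_+)$ be a coupled $\mathrm{SU}(3)$-structure on a (real) Lie algebra $\mathfrak{h}$ of dimension $6$ and let $D=\rho(A)$, $A\in\mathfrak{sl}(3,\mathbb{C})$, be a derivation of $\mathfrak{h}$ whose matrix representation with respect to an $\mathrm{SU}(3)$-basis $\{e_1,\ldots,e_6\}$ of $\mathfrak{h}$ is $$D=\begin{pmatrix} a_{11}&a_{12}&a_{13}&a_{14}&a_{15}&a_{16}\\ -a_{12}&a_{11}&-a_{14}&a_{13}&-a_{16}&a_{15}\\ a_{31}&a_{32}&a_{33}&a_{34}&a_{35}&a_{36}\\ -a_{32}&a_{31}&-a_{34}&a_{33}&-a_{36}&a_{35}\\ a_{51}&a_{52}&a_{53}&a_{54}&-a_{11}-a_{33}&-a_{12}-a_{34}\\ -a_{52}&a_{51}&-a_{54}&a_{53}&a_{12}+a_{34}&-a_{11}-a_{33}\end{pmatrix},\qquad a_{ij}\in\mathbb{R}.$$ Then the Lie algebra $\mathfrak{g}=\mathfrak{h}\oplus_D\mathbb{R}\xi$, with Lie bracket given by $[U,V]=[U,V]|_{\mathfrak{h}}$ and $[\xi,U]=D(U)$ for all $U,V\in\mathfrak{h}$, has a locally conformal calibrated $G_2$-structure.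
   Context: Notation: $e^{ij\cdots}=e^i\wedge e^j\wedge\cdots$. An $\mathrm{SU}(3)$-structure on a six-dimensional Lie algebra $\mathfrak{h}$ is a pair $(\omega,\psi_+)$ of a 2-form and a 3-form on $\mathfrak{h}$ which can be expressed as $\omega=e^{12}+e^{34}+e^{56}$, $\psi_+=e^{135}-e^{146}-e^{236}-e^{245}$ with respect to some basis $\{e^1,\ldots,e^6\}$ of $\mathfrak{h}^*$; the dual basis $\{e_1,\ldots,e_6\}$ of $\mathfrak{h}$ is called an $\mathrm{SU}(3)$-basis. The $\mathrm{SU}(3)$-structure is coupled if $\hat d\omega=c\,\psi_+$ for some nonzero real constant $c$, where $\hat d$ is the Chevalley–Eilenberg differential on $\mathfrak{h}^*$. The map $\rho:\mathfrak{gl}(3,\mathbb{C})\to\mathfrak{gl}(6,\mathbb{R})$ sends $A=(A_{ij})$ to the block matrix $(B_{ij})_{i,j=1}^3$ with $B_{ij}=\begin{pmatrix}\mathrm{Re}\,A_{ij}&\mathrm{Im}\,A_{ij}\\-\mathrm{Im}\,A_{ij}&\mathrm{Re}\,A_{ij}\end{pmatrix}$. A $G_2$-structure on a seven-dimensional Lie algebra $\mathfrak{g}$ is a 3-form $\varphi$ on $\mathfrak{g}$ which can be written as $\varphi=e^{127}+e^{347}+e^{567}+e^{135}-e^{146}-e^{236}-e^{245}$ with respect to some basis $\{e^1,\ldots,e^7\}$ of $\mathfrak{g}^*$. It is locally conformal calibrated if $d\varphi=-\theta\wedge\varphi$ for some closed 1-form $\theta$ on $\mathfrak{g}$, where $d$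 is the Chevalley–Eilenberg differential on $\mathfrak{g}^*$. *)

theory Defs
  imports "HOL-Analysis.Analysis"
begin

section \<open>Lie algebras\<close>

definition lie_algebra :: "('a::real_vector \<Rightarrow> 'a \<Rightarrow> 'a) \<Rightarrow> bool" where
  "lie_algebra br \<longleftrightarrow>
     (\<forall>u. linear (br u)) \<and> (\<forall>v. linear (\<lambda>u. br u v)) \<and>
     (\<forall>u. br u u = 0) \<and>
     (\<forall>u v w. br u (br v w) + br v (br w u) + br w (br u v) = 0)"

definition derivation :: "('a::real_vector \<Rightarrow> 'a \<Rightarrow> 'a) \<Rightarrow> ('a \<Rightarrow> 'a) \<Rightarrow> bool" where
  "derivation br D \<longleftrightarrow>
     linear D \<and> (\<forall>u v. D (br u v) = br (D u) v + br u (D v))"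

text \<open>The bracket of \<open>\<hh> \<oplus>\<^sub>D \<real>\<xi>\<close>, where \<open>(U, s)\<close> stands for \<open>U + s \<xi>\<close>.  Bilinearity and
  antisymmetry extend \<open>[U, V]\<close> and \<open>[\<xi>, U] = D U\<close> in this unique way.\<close>

definition ext_bracket ::
    "('a::real_vector \<Rightarrow> 'a \<Rightarrow> 'a) \<Rightarrow> ('a \<Rightarrow> 'a) \<Rightarrow> 'a \<times> real \<Rightarrow> 'a \<times> real \<Rightarrow> 'a \<times> real" where
  "ext_bracket br D x y =
     (br (fst x) (fst y) + snd x *\<^sub>R D (fst y) - snd y *\<^sub>R D (fst x), 0)"


section \<open>Exterior forms\<close>

text \<open>A \<open>k\<close>-form is a function of the list of its arguments, extended by \<open>0\<close> to the lists whose
  length is not \<open>k\<close>.  Equality of \<open>k\<close>-forms is then equality of functions, and the wedge product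
  and the differential need no degree argument.\<close>

definition form :: "nat \<Rightarrow> ('a::real_vector list \<Rightarrow> real) \<Rightarrow> bool" where
  "form k \<alpha> \<longleftrightarrow>
     (\<forall>xs. length xs \<noteq> k \<longrightarrow> \<alpha> xs = 0) \<and>
     (\<forall>xs i. length xs = k \<longrightarrow> i < k \<longrightarrow> linear (\<lambda>x. \<alpha> (xs[i := x]))) \<and>
     (\<forall>xs i j. length xs = k \<longrightarrow> i < j \<longrightarrow> j < k \<longrightarrow> xs ! i = xs ! j \<longrightarrow> \<alpha> xs = 0)"

text \<open>The shuffle formula: \<open>I\<close> is the set of positions of the arguments handed to \<open>\<alpha>\<close>, and the
  exponent counts the inversions of the corresponding shuffle.  For 1-forms it gives
  \<open>(\<alpha> \<and> \<beta>)(x, y) = \<alpha>(x) \<beta>(y) - \<alpha>(y) \<beta>(x)\<close>.\<close>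

definition wedge :: "('a list \<Rightarrow> real) \<Rightarrow> ('a list \<Rightarrow> real) \<Rightarrow> 'a list \<Rightarrow> real" where
  "wedge \<alpha> \<beta> xs =
     (\<Sum>I\<in>Pow {..<length xs}.
        (-1) ^ card {(i, j). i \<in> I \<and> j \<in> {..<length xs} - I \<and> j < i}
          * \<alpha> (nths xs I) * \<beta> (nths xs (- I)))"

text \<open>The Chevalley--Eilenberg differential
  \<open>d\<alpha>(x\<^sub>0, \<dots>, x\<^sub>k) = \<Sum>\<^bsub>i<j\<^esub> (-1)\<^bsup>i+j\<^esup> \<alpha>([x\<^sub>i, x\<^sub>j], x\<^sub>0, \<dots>, x\<^sub>k)\<close>, with \<open>x\<^sub>i\<close> and \<open>x\<^sub>j\<close>
  omitted from the remaining arguments; for a 1-form, \<open>d\<alpha>(x, y) = - \<alpha>([x, y])\<close>.\<close>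

definition ce_d :: "('a \<Rightarrow> 'a \<Rightarrow> 'a) \<Rightarrow> ('a list \<Rightarrow> real) \<Rightarrow> 'a list \<Rightarrow> real" where
  "ce_d br \<alpha> xs =
     (\<Sum>j<length xs. \<Sum>i<j. (-1) ^ (i + j) * \<alpha> (br (xs ! i) (xs ! j) # nths xs (- {i, j})))"

definition is_basis :: "nat \<Rightarrow> (nat \<Rightarrow> 'a::real_vector) \<Rightarrow> bool" where
  "is_basis n e \<longleftrightarrow>
     inj_on e {1..n} \<and> independent (e ` {1..n}) \<and> span (e ` {1..n}) = UNIV"

text \<open>The member \<open>e\<^sup>i\<close> of the basis dual to \<open>e\<^sub>1, \<dots>, e\<^sub>n\<close>, as a 1-form.  Every basis of the dual
  space is dual to a unique basis, so \<open>e\<close> ranging over bases amounts to ranging over coframes.\<close>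

definition dual_basis :: "nat \<Rightarrow> (nat \<Rightarrow> 'a::real_vector) \<Rightarrow> nat \<Rightarrow> 'a list \<Rightarrow> real" where
  "dual_basis n e i xs =
     (case xs of [x] \<Rightarrow> representation (e ` {1..n}) x (e i) | _ \<Rightarrow> 0)"

text \<open>\<open>monomial n e [i, j, \<dots>]\<close> is \<open>e\<^sup>i \<and> e\<^sup>j \<and> \<dots>\<close>; the empty product is the 0-form 1.\<close>

definition monomial :: "nat \<Rightarrow> (nat \<Rightarrow> 'a::real_vector) \<Rightarrow> nat list \<Rightarrow> 'a list \<Rightarrow> real" where
  "monomial n e is =
     foldr (\<lambda>i. wedge (dual_basis n e i)) is (\<lambda>xs. if xs = [] then 1 else 0)"


section \<open>\<open>SU(3)\<close>- and \<open>G\<^sub>2\<close>-structures\<close>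

definition SU3_basis ::
    "('a::real_vector list \<Rightarrow> real) \<Rightarrow> ('a list \<Rightarrow> real) \<Rightarrow> (nat \<Rightarrow> 'a) \<Rightarrow> bool" where
  "SU3_basis \<omega> \<psi> e \<longleftrightarrow>
     is_basis 6 e \<and>
     \<omega> = (\<lambda>xs. monomial 6 e [1,2] xs + monomial 6 e [3,4] xs + monomial 6 e [5,6] xs) \<and>
     \<psi> = (\<lambda>xs. monomial 6 e [1,3,5] xs - monomial 6 e [1,4,6] xs
              - monomial 6 e [2,3,6] xs - monomial 6 e [2,4,5] xs)"

definition SU3_structure ::
    "('a::real_vector list \<Rightarrow> real) \<Rightarrow> ('a list \<Rightarrow> real) \<Rightarrow> bool" where
  "SU3_structure \<omega> \<psi> \<longleftrightarrow> form 2 \<omega> \<and> form 3 \<psi> \<and> (\<exists>e. SU3_basis \<omega> \<psi> e)"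

definition coupled ::
    "('a::real_vector \<Rightarrow> 'a \<Rightarrow> 'a) \<Rightarrow> ('a list \<Rightarrow> real) \<Rightarrow> ('a list \<Rightarrow> real) \<Rightarrow> bool" where
  "coupled br \<omega> \<psi> \<longleftrightarrow>
     SU3_structure \<omega> \<psi> \<and> (\<exists>c. c \<noteq> 0 \<and> ce_d br \<omega> = (\<lambda>xs. c * \<psi> xs))"

definition G2_structure :: "('a::real_vector list \<Rightarrow> real) \<Rightarrow> bool" where
  "G2_structure \<phi> \<longleftrightarrow>
     form 3 \<phi> \<and>
     (\<exists>e. is_basis 7 e \<and>
        \<phi> = (\<lambda>xs. monomial 7 e [1,2,7] xs + monomial 7 e [3,4,7] xs + monomial 7 e [5,6,7] xs
               + monomial 7 e [1,3,5] xs - monomial 7 e [1,4,6] xs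
               - monomial 7 e [2,3,6] xs - monomial 7 e [2,4,5] xs))"

definition loc_conf_calibrated ::
    "('a::real_vector \<Rightarrow> 'a \<Rightarrow> 'a) \<Rightarrow> ('a list \<Rightarrow> real) \<Rightarrow> bool" where
  "loc_conf_calibrated br \<phi> \<longleftrightarrow>
     (\<exists>\<theta>. form 1 \<theta> \<and> ce_d br \<theta> = (\<lambda>xs. 0) \<and> ce_d br \<phi> = (\<lambda>xs. - wedge \<theta> \<phi> xs))"


section \<open>The embedding of complex \<open>3 \<times> 3\<close> matrices into real \<open>6 \<times> 6\<close> matrices\<close>

text \<open>Rows and columns \<open>r, s\<close> run through \<open>1, \<dots>, 6\<close> and lie in the block \<open>B\<^sub>i\<^sub>j\<close> with
  \<open>i = \<lceil>r/2\<rceil>\<close>, \<open>j = \<lceil>s/2\<rceil>\<close>.  In the index type \<open>3\<close> the numeral \<open>3\<close> is \<open>0\<close>, so \<open>1, 2, 3\<close> are its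
  three elements.\<close>

definition rho :: "complex^3^3 \<Rightarrow> nat \<Rightarrow> nat \<Rightarrow> real" where
  "rho A r s =
     (let z = A $ of_nat ((r + 1) div 2) $ of_nat ((s + 1) div 2)
      in if odd r then (if odd s then Re z else Im z)
                  else (if odd s then - Im z else Re z))"

text \<open>The \<open>j\<close>-th column of the matrix \<open>M\<close> holds the coordinates of \<open>D e\<^sub>j\<close>.\<close>

definition has_matrix ::
    "nat \<Rightarrow> (nat \<Rightarrow> 'a::real_vector) \<Rightarrow> ('a \<Rightarrow> 'a) \<Rightarrow> (nat \<Rightarrow> nat \<Rightarrow> real) \<Rightarrow> bool" where
  "has_matrix n e D M \<longleftrightarrow> (\<forall>j\<in>{1..n}. D (e j) = (\<Sum>i=1..n. M i j *\<^sub>R e i))"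

text \<open>For trace-free \<open>A\<close>, the matrix \<open>rho A\<close> written out.\<close>

lemma rho_sl3:
  assumes "trace A = 0"
  obtains a11 a12 a13 a14 a15 a16 a31 a32 a33 a34 a35 a36 a51 a52 a53 a54 where
    "map (\<lambda>r. map (rho A r) [1,2,3,4,5,6]) [1,2,3,4,5,6] =
      [[ a11, a12,  a13, a14,  a15,        a16],
       [-a12, a11, -a14, a13, -a16,        a15],
       [ a31, a32,  a33, a34,  a35,        a36],
       [-a32, a31, -a34, a33, -a36,        a35],
       [ a51, a52,  a53, a54, -a11 - a33, -a12 - a34],
       [-a52, a51, -a54, a53,  a12 + a34, -a11 - a33]]"
proof
  have "A $ 3 $ 3 = - A $ 1 $ 1 - A $ 2 $ 2"
    using assms by (simp add: trace_def sum_3 add_eq_0_iff algebra_simps)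
  then show "map (\<lambda>r. map (rho A r) [1,2,3,4,5,6]) [1,2,3,4,5,6] =
      [[ Re (A$1$1), Im (A$1$1),  Re (A$1$2), Im (A$1$2),  Re (A$1$3), Im (A$1$3)],
       [-Im (A$1$1), Re (A$1$1), -Im (A$1$2), Re (A$1$2), -Im (A$1$3), Re (A$1$3)],
       [ Re (A$2$1), Im (A$2$1),  Re (A$2$2), Im (A$2$2),  Re (A$2$3), Im (A$2$3)],
       [-Im (A$2$1), Re (A$2$1), -Im (A$2$2), Re (A$2$2), -Im (A$2$3), Re (A$2$3)],
       [ Re (A$3$1), Im (A$3$1),  Re (A$3$2), Im (A$3$2),
           - Re (A$1$1) - Re (A$2$2), - Im (A$1$1) - Im (A$2$2)],
       [-Im (A$3$1), Re (A$3$1), -Im (A$3$2), Re (A$3$2),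
           Im (A$1$1) + Im (A$2$2), - Re (A$1$1) - Re (A$2$2)]]"
    by (simp add: rho_def)
qed

end

theory Submission
  imports Defs
begin

text \<open>
  Write \<open>\<eta>\<close> for the 1-form on \<open>\<hh> \<oplus>\<^sub>D \<real>\<xi>\<close> that vanishes on \<open>\<hh>\<close> and has \<open>\<eta>(\<xi>) = 1\<close>, and let
  \<open>d\<^sub>\<hh>\<omega> = c \<psi>\<close>.  The required structure is \<open>\<phi> = \<omega> \<and> \<eta> + \<psi>\<close> with \<open>\<theta> = c \<eta>\<close>.
  In the basis \<open>e\<^sub>1, \<dots>, e\<^sub>6, \<xi>\<close> the form \<open>\<phi>\<close> has the \<open>G\<^sub>2\<close> normal form by construction, so only
  \<open>d\<phi> = - \<theta> \<and> \<phi>\<close> needs an argument.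

  A bracket never has a \<open>\<xi>\<close>-component, hence \<open>d\<eta> = 0\<close>.  For a form \<open>\<alpha>\<close> pulled back from \<open>\<hh>\<close> one has
  \<open>d\<alpha> = d\<^sub>\<hh>\<alpha> - \<eta> \<and> D\<cdot>\<alpha>\<close>, where \<open>D\<cdot>\<alpha>\<close> is the sum of the forms obtained by applying \<open>D\<close> to one
  argument of \<open>\<alpha>\<close>.  Wedging with \<open>\<eta>\<close> kills the second term, so \<open>d(\<omega> \<and> \<eta>) = c \<psi> \<and> \<eta> = - \<theta> \<and> \<psi>\<close>, and
  \<open>\<theta> \<and> \<psi> = \<theta> \<and> \<phi>\<close>.  It remains to see that \<open>d\<psi> = 0\<close>, which takes two facts.

  First, \<open>d\<^sub>\<hh>\<psi> = 0\<close>: the form \<open>\<psi>\<close> is a multiple of \<open>d\<^sub>\<hh>\<omega>\<close>, because \<open>c \<noteq> 0\<close>, and \<open>d\<^sub>\<hh>\<^sup>2 = 0\<close> by the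
  Jacobi identity (\<open>ce_d_ce_d_2_form\<close>).  Secondly, \<open>D\<cdot>\<psi> = 0\<close> (\<open>sl3_preserves_psi\<close>): the form \<open>\<psi>\<close> is the
  real part of the complex determinant in the coordinates \<open>z\<^sup>k = e\<^bsup>2k-1\<^esup> + \<i> e\<^bsup>2k\<^esup>\<close>, in which \<open>rho A\<close>
  acts as the complex conjugate of \<open>A\<close>, and a linear map acts infinitesimally on a determinant by
  its trace.  Both facts enter the evaluation of \<open>d\<phi>\<close> on four vectors in \<open>ce_d_G2_form\<close>.
\<close>

section \<open>Wedge products with a 1-form and values of monomials\<close>

lemma nths_singleton_index:
  assumes "i < length xs"
  shows "nths xs {i} = [xs ! i]"
  using assms
proof (induction xs arbitrary: i)
  case (Cons x xs)
  show ?case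
  proof (cases i)
    case 0
    then show ?thesis by (simp add: nths_Cons)
  next
    case (Suc m)
    then have "{j. Suc j \<in> {i}} = {m}" by auto
    then show ?thesis using Cons Suc by (simp add: nths_Cons)
  qed
qed simp

lemma length_nths_diff:
  assumes "I \<subseteq> {..<length xs}"
  shows "length (nths xs (- I)) = length xs - card I"
proof -
  have "{i. i < length xs \<and> i \<in> - I} = {..<length xs} - I" by auto
  then show ?thesis
    using assms by (simp add: length_nths card_Diff_subset finite_subset)
qed

text \<open>Only the shuffles that hand a single argument to \<open>\<alpha>\<close> contribute, which turns the sum over
  subsets into an expansion along a row.  All wedge products below are evaluated through it.\<close>

lemma wedge_one_form_left:
  assumes "\<And>ys. length ys \<noteq> 1 \<Longrightarrow> \<alpha> ys = 0"
  shows "wedge \<alpha> \<beta> xs = (\<Sum>i<length xs. (-1) ^ i * \<alpha> [xs ! i] * \<beta> (nths xs (- {i})))"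
proof -
  let ?f = "\<lambda>I. (-1) ^ card {(i, j). i \<in> I \<and> j \<in> {..<length xs} - I \<and> j < i}
          * \<alpha> (nths xs I) * \<beta> (nths xs (- I))"
  have "wedge \<alpha> \<beta> xs = sum ?f ((\<lambda>i. {i}) ` {..<length xs})"
    unfolding wedge_def
  proof (rule sum.mono_neutral_right)
    show "\<forall>I\<in>Pow {..<length xs} - (\<lambda>i. {i}) ` {..<length xs}. ?f I = 0"
    proof
      fix I assume I: "I \<in> Pow {..<length xs} - (\<lambda>i. {i}) ` {..<length xs}"
      have "{i. i < length xs \<and> i \<in> I} = I" using I by auto
      moreover have "card I \<noteq> 1"
        using I by (auto simp: card_1_singleton_iff)
      ultimately have "length (nths xs I) \<noteq> 1" by (simp add: length_nths)
      then show "?f I = 0" using assms by simp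
    qed
  qed auto
  also have "\<dots> = (\<Sum>i<length xs. ?f {i})"
    by (simp add: sum.reindex)
  also have "\<dots> = (\<Sum>i<length xs. (-1) ^ i * \<alpha> [xs ! i] * \<beta> (nths xs (- {i})))"
  proof (rule sum.cong)
    fix i assume i: "i \<in> {..<length xs}"
    have "{(i', j). i' \<in> {i} \<and> j \<in> {..<length xs} - {i} \<and> j < i'} = Pair i ` {..<i}"
      using i by auto
    then show "?f {i} = (-1) ^ i * \<alpha> [xs ! i] * \<beta> (nths xs (- {i}))"
      using i by (simp add: card_image inj_on_def nths_singleton_index)
  qed simp
  finally show ?thesis .
qed

lemma dual_basis_length:
  "length xs \<noteq> 1 \<Longrightarrow> dual_basis n e i xs = 0"
  by (auto simp: dual_basis_def split: list.split)

lemma wedge_length_one_left: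
  assumes "\<And>ys. length ys \<noteq> 1 \<Longrightarrow> \<alpha> ys = 0"
    and "\<And>ys. length ys \<noteq> k \<Longrightarrow> \<beta> ys = 0"
    and "length xs \<noteq> Suc k"
  shows "wedge \<alpha> \<beta> xs = 0"
proof -
  have "\<beta> (nths xs (- {i})) = 0" if "i < length xs" for i
    using that assms(2,3) by (simp add: length_nths_diff)
  then show ?thesis by (simp add: wedge_one_form_left assms(1))
qed

lemma monomial_length:
  "length xs \<noteq> length is \<Longrightarrow> monomial n e is xs = 0"
proof (induction "is" arbitrary: xs)
  case Nil
  then show ?case by (simp add: monomial_def)
next
  case (Cons i "is")
  have "wedge (dual_basis n e i) (monomial n e is) xs = 0"
    by (rule wedge_length_one_left[where k = "length is"])
      (use Cons dual_basis_length in auto)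
  then show ?case by (simp add: monomial_def)
qed

lemma wedge_one_form_2:
  assumes "\<And>ys. length ys \<noteq> 1 \<Longrightarrow> \<alpha> ys = 0"
  shows "wedge \<alpha> \<beta> [x, y] = \<alpha> [x] * \<beta> [y] - \<alpha> [y] * \<beta> [x]"
  by (simp add: wedge_one_form_left[of \<alpha>, OF assms] nths_Cons numeral_2_eq_2)

lemma wedge_one_form_3:
  assumes "\<And>ys. length ys \<noteq> 1 \<Longrightarrow> \<alpha> ys = 0"
  shows "wedge \<alpha> \<beta> [x, y, z] = \<alpha> [x] * \<beta> [y, z] - \<alpha> [y] * \<beta> [x, z] + \<alpha> [z] * \<beta> [x, y]"
  by (simp add: wedge_one_form_left[of \<alpha>, OF assms] nths_Cons numeral_3_eq_3)

lemma wedge_one_form_4: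
  assumes "\<And>ys. length ys \<noteq> 1 \<Longrightarrow> \<alpha> ys = 0"
  shows "wedge \<alpha> \<beta> [x, y, z, w] = \<alpha> [x] * \<beta> [y, z, w] - \<alpha> [y] * \<beta> [x, z, w]
    + \<alpha> [z] * \<beta> [x, y, w] - \<alpha> [w] * \<beta> [x, y, z]"
  by (simp add: wedge_one_form_left[of \<alpha>, OF assms] nths_Cons numeral_eq_Suc)

lemma monomial_1: "monomial n e [i] [x] = dual_basis n e i [x]"
  by (simp add: monomial_def wedge_one_form_left[of "dual_basis n e i", OF dual_basis_length])

lemma monomial_2:
  "monomial n e [i, j] [x, y] =
    dual_basis n e i [x] * dual_basis n e j [y] - dual_basis n e i [y] * dual_basis n e j [x]"
proof -
  have "monomial n e [i, j] = wedge (dual_basis n e i) (monomial n e [j])"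
    by (simp add: monomial_def)
  then show ?thesis by (simp add: wedge_one_form_2 dual_basis_length monomial_1)
qed

lemma monomial_3:
  "monomial n e [i, j, k] [x, y, z] =
     dual_basis n e i [x] * monomial n e [j, k] [y, z]
   - dual_basis n e i [y] * monomial n e [j, k] [x, z]
   + dual_basis n e i [z] * monomial n e [j, k] [x, y]"
proof -
  have "monomial n e [i, j, k] = wedge (dual_basis n e i) (monomial n e [j, k])"
    by (simp add: monomial_def)
  then show ?thesis by (simp add: wedge_one_form_3 dual_basis_length)
qed

section \<open>Bases and their dual coordinates\<close>

lemma linear_dual_basis:
  assumes "is_basis n e"
  shows "linear (\<lambda>x. dual_basis n e i [x])"
  using assms unfolding is_basis_def dual_basis_def
  by (auto intro!: linearI simp: real_vector.representation_add real_vector.representation_scale)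

lemma dual_basis_delta:
  assumes "is_basis n e" "i \<in> {1..n}" "j \<in> {1..n}"
  shows "dual_basis n e i [e j] = (if i = j then 1 else 0)"
proof -
  have "dual_basis n e i [e j] = (if e j = e i then 1 else 0)"
    using assms by (simp add: is_basis_def dual_basis_def real_vector.representation_basis)
  moreover have "e j = e i \<longleftrightarrow> i = j"
    using assms inj_on_eq_iff[of e "{1..n}" j i] by (auto simp: is_basis_def)
  ultimately show ?thesis by simp
qed

lemma is_basis_expand:
  assumes "is_basis n e"
  shows "x = (\<Sum>i=1..n. dual_basis n e i [x] *\<^sub>R e i)"
proof -
  have "x = (\<Sum>b\<in>e ` {1..n}. representation (e ` {1..n}) x b *\<^sub>R b)"
    using assms unfolding is_basis_def
    by (intro real_vector.sum_representation_eq[symmetric]) auto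
  also have "\<dots> = (\<Sum>i=1..n. dual_basis n e i [x] *\<^sub>R e i)"
    using assms by (simp add: is_basis_def dual_basis_def sum.reindex)
  finally show ?thesis .
qed

text \<open>Functionals biorthogonal to a family make it linearly independent, and the expansion makes it
  spanning; this yields the basis property and identifies the dual basis in one step.\<close>

lemma is_basisI:
  assumes lin: "\<And>i. i \<in> {1..n} \<Longrightarrow> linear (f i)"
    and delta: "\<And>i j. i \<in> {1..n} \<Longrightarrow> j \<in> {1..n} \<Longrightarrow> f i (e j) = (if i = j then 1 else 0)"
    and expand: "\<And>x. x = (\<Sum>i=1..n. f i x *\<^sub>R e i)"
  shows "is_basis n e"
    and "i \<in> {1..n} \<Longrightarrow> dual_basis n e i [x] = f i x"
proof -
  \<comment> \<open>If \<open>e i = e j\<close>, then \<open>f i\<close> takes the value \<open>1\<close> at \<open>e j\<close>.\<close>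
  have inj: "inj_on e {1..n}"
  proof (rule inj_onI)
    fix i j assume ij: "i \<in> {1..n}" "j \<in> {1..n}" "e i = e j"
    then have "(if i = j then 1 else 0) = (1::real)"
      using delta[OF ij(1,1)] delta[OF ij(1,2)] by simp
    then show "i = j" by (simp split: if_splits)
  qed
  have ind: "independent (e ` {1..n})"
  proof (rule real_vector.independent_if_scalars_zero)
    fix g v assume s: "(\<Sum>v\<in>e ` {1..n}. g v *\<^sub>R v) = 0" and "v \<in> e ` {1..n}"
    then obtain i where i: "i \<in> {1..n}" "v = e i" by auto
    have "0 = f i (\<Sum>j=1..n. g (e j) *\<^sub>R e j)"
      using s inj lin[OF i(1)] by (simp add: sum.reindex linear_0)
    also have "\<dots> = (\<Sum>j=1..n. if i = j then g (e j) else 0)"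
      unfolding linear_sum[OF lin[OF i(1)]] linear_scale[OF lin[OF i(1)]]
      by (rule sum.cong) (use delta i in auto)
    also have "\<dots> = g v" using i by simp
    finally show "g v = 0" by simp
  qed simp
  have "x \<in> span (e ` {1..n})" for x
    by (subst expand[of x]) (intro span_sum span_scale span_base imageI)
  then show b: "is_basis n e" using inj ind by (auto simp: is_basis_def)
  show "dual_basis n e i [x] = f i x" if i: "i \<in> {1..n}"
  proof (rule linear_eq_on[of "\<lambda>x. dual_basis n e i [x]" "f i" x "e ` {1..n}"])
    show "x \<in> span (e ` {1..n})" using b by (simp add: is_basis_def)
    show "linear (f i)" using i by (rule lin)
    fix y assume "y \<in> e ` {1..n}"
    then obtain j where "j \<in> {1..n}" "y = e j" by auto
    with i show "dual_basis n e i [y] = f i y"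
      by (simp only: delta dual_basis_delta[OF b])
  qed (rule linear_dual_basis[OF b])
qed

definition ext_basis :: "(nat \<Rightarrow> 'a::real_vector) \<Rightarrow> nat \<Rightarrow> 'a \<times> real" where
  "ext_basis e i = (if i = 7 then (0, 1) else (e i, 0))"

lemma ext_basis:
  assumes "is_basis 6 e"
  shows is_basis_ext_basis: "is_basis 7 (ext_basis e)"
    and dual_ext_basis: "i \<in> {1..6} \<Longrightarrow> dual_basis 7 (ext_basis e) i [x] = dual_basis 6 e i [fst x]"
    and dual_ext_basis_7: "dual_basis 7 (ext_basis e) 7 [x] = snd x"
proof -
  let ?f = "\<lambda>i x. if i = 7 then snd x else dual_basis 6 e i [fst x]"
  have lin: "linear (?f i)" for i
    using linear_compose[OF linear_fst linear_dual_basis[OF assms], of i] linear_snd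
    by (cases "i = 7") (simp_all add: o_def)
  have delta: "?f i (ext_basis e j) = (if i = j then 1 else 0)"
    if "i \<in> {1..7}" "j \<in> {1..7}" for i j
    using that linear_0[OF linear_dual_basis[OF assms], of i]
    by (auto simp: ext_basis_def dual_basis_delta[OF assms])
  have "{1..7} = insert 7 {1..6::nat}" by auto
  then have "(\<Sum>i=1..7. ?f i x *\<^sub>R ext_basis e i)
      = (0, snd x) + (\<Sum>i=1..6. (dual_basis 6 e i [fst x] *\<^sub>R e i, 0))" for x
    by (auto simp: ext_basis_def intro!: sum.cong)
  then have expand: "x = (\<Sum>i=1..7. ?f i x *\<^sub>R ext_basis e i)" for x
    using is_basis_expand[OF assms, of "fst x", symmetric]
    by (intro prod_eqI) (simp_all add: fst_sum snd_sum)
  show "is_basis 7 (ext_basis e)"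
    using is_basisI(1)[of 7 ?f, OF lin delta expand] by simp
  have coord: "i \<in> {1..7} \<Longrightarrow> dual_basis 7 (ext_basis e) i [x] = ?f i x" for i x
    by (rule is_basisI(2)[of 7 ?f, OF lin delta expand])
  show "dual_basis 7 (ext_basis e) i [x] = dual_basis 6 e i [fst x]" if "i \<in> {1..6}"
    using coord[of i x] that by auto
  show "dual_basis 7 (ext_basis e) 7 [x] = snd x"
    using coord[of 7 x] by simp
qed

section \<open>Forms of degree two and three\<close>

lemma form_linear:
  assumes "form k \<alpha>" "length xs = k" "i < k"
  shows "linear (\<lambda>x. \<alpha> (xs[i := x]))"
  using assms unfolding form_def by blast

lemma form_2_linear:
  assumes "form 2 \<omega>"
  shows "linear (\<lambda>x. \<omega> [x, y])" "linear (\<lambda>y. \<omega> [x, y])"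
proof -
  have "linear (\<lambda>z. \<omega> ([x, y][i := z]))" if "i < 2" for i x y
    using form_linear[OF assms _ that, of "[x, y]"] by simp
  from this[of 0 undefined y] this[of 1 x undefined]
  show "linear (\<lambda>x. \<omega> [x, y])" "linear (\<lambda>y. \<omega> [x, y])" by simp_all
qed

lemma form_2_antisym:
  assumes "form 2 \<omega>"
  shows "\<omega> [y, x] = - \<omega> [x, y]"
proof -
  have alt: "\<omega> [u, u] = 0" for u
  proof -
    have "length [u, u] = 2" "(0::nat) < 1" "1 < (2::nat)" "[u, u] ! 0 = [u, u] ! 1" by simp_all
    then show ?thesis using assms unfolding form_def by blast
  qed
  have "\<omega> [x + y, x + y] = \<omega> [x, x] + \<omega> [x, y] + \<omega> [y, x] + \<omega> [y, y]"
    using form_2_linear[OF assms, THEN linear_add] by simp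
  then show ?thesis by (simp add: alt)
qed

lemma form_3_linear:
  assumes "form 3 \<psi>"
  shows "linear (\<lambda>x. \<psi> [x, y, z])" "linear (\<lambda>y. \<psi> [x, y, z])" "linear (\<lambda>z. \<psi> [x, y, z])"
proof -
  have "linear (\<lambda>w. \<psi> ([x, y, z][i := w]))" if "i < 3" for i x y z
    using form_linear[OF assms _ that, of "[x, y, z]"] by simp
  from this[of 0 undefined y z] this[of 1 x undefined z] this[of 2 x y undefined]
  show "linear (\<lambda>x. \<psi> [x, y, z])" "linear (\<lambda>y. \<psi> [x, y, z])" "linear (\<lambda>z. \<psi> [x, y, z])"
    by simp_all
qed

lemma form_3_alternating:
  assumes "form 3 \<psi>"
  shows "\<psi> [x, x, y] = 0" "\<psi> [x, y, x] = 0" "\<psi> [y, x, x] = 0"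
proof -
  have "\<psi> xs = 0" if "length xs = 3" "i < j" "j < 3" "xs ! i = xs ! j" for xs i j
    using assms that by (auto simp: form_def)
  from this[of "[x, x, y]" 0 1] this[of "[x, y, x]" 0 2] this[of "[y, x, x]" 1 2]
  show "\<psi> [x, x, y] = 0" "\<psi> [x, y, x] = 0" "\<psi> [y, x, x] = 0" by simp_all
qed

lemma form_3_antisym_12:
  assumes "form 3 \<psi>"
  shows "\<psi> [y, x, z] = - \<psi> [x, y, z]"
proof -
  have "\<psi> [x + y, x + y, z] = \<psi> [x, x, z] + \<psi> [x, y, z] + \<psi> [y, x, z] + \<psi> [y, y, z]"
    using form_3_linear(1,2)[OF assms, THEN linear_add] by simp
  then show ?thesis by (simp add: form_3_alternating[OF assms])
qed

lemma form_3_antisym_23: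
  assumes "form 3 \<psi>"
  shows "\<psi> [x, z, y] = - \<psi> [x, y, z]"
proof -
  have "\<psi> [x, y + z, y + z] = \<psi> [x, y, y] + \<psi> [x, y, z] + \<psi> [x, z, y] + \<psi> [x, z, z]"
    using form_3_linear(2,3)[OF assms, THEN linear_add] by simp
  then show ?thesis by (simp add: form_3_alternating[OF assms])
qed

lemma form_3I:
  assumes "\<And>xs. length xs \<noteq> 3 \<Longrightarrow> \<alpha> xs = 0"
    and "\<And>y z. linear (\<lambda>x. \<alpha> [x, y, z])" "\<And>x z. linear (\<lambda>y. \<alpha> [x, y, z])"
      "\<And>x y. linear (\<lambda>z. \<alpha> [x, y, z])"
    and "\<And>x y. \<alpha> [x, x, y] = 0" "\<And>x y. \<alpha> [x, y, x] = 0" "\<And>x y. \<alpha> [y, x, x] = 0"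
  shows "form 3 \<alpha>"
proof -
  have three: "\<exists>x y z. xs = [x, y, z]" if "length xs = 3" for xs :: "'a list"
    using that by (auto simp: numeral_3_eq_3 length_Suc_conv)
  show ?thesis
    unfolding form_def
  proof (intro conjI allI impI)
    fix xs :: "'a list" and i :: nat
    assume "length xs = 3" "i < 3"
    moreover from \<open>i < 3\<close> have "i = 0 \<or> i = 1 \<or> i = 2" by auto
    ultimately show "linear (\<lambda>x. \<alpha> (xs[i := x]))"
      using three[of xs] assms(2-4) by auto
  next
    fix xs :: "'a list" and i j :: nat
    assume "length xs = 3" and ij: "i < j" "j < 3" and "xs ! i = xs ! j"
    moreover from ij have "i = 0 \<and> j = 1 \<or> i = 0 \<and> j = 2 \<or> i = 1 \<and> j = 2" by auto
    ultimately show "\<alpha> xs = 0"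
      using three[of xs] assms(5-7) by auto
  qed (use assms(1) in auto)
qed

section \<open>The Chevalley--Eilenberg differential\<close>

lemma ce_d_1: "ce_d br \<alpha> [x, y] = - \<alpha> [br x y]"
  by (simp add: ce_d_def nths_Cons numeral_2_eq_2)

lemma ce_d_2:
  "ce_d br \<alpha> [x, y, z] = - \<alpha> [br x y, z] + \<alpha> [br x z, y] - \<alpha> [br y z, x]"
  by (simp add: ce_d_def nths_Cons numeral_3_eq_3)

lemma ce_d_3:
  "ce_d br \<alpha> [x, y, z, w] =
     - \<alpha> [br x y, z, w] + \<alpha> [br x z, y, w] - \<alpha> [br x w, y, z]
     - \<alpha> [br y z, x, w] + \<alpha> [br y w, x, z] - \<alpha> [br z w, x, y]"
  by (simp add: ce_d_def nths_Cons numeral_eq_Suc)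

lemma ce_d_length:
  assumes "\<And>ys. length ys \<noteq> k \<Longrightarrow> \<alpha> ys = 0" and "length xs \<noteq> Suc k"
  shows "ce_d br \<alpha> xs = 0"
  unfolding ce_d_def
proof (intro sum.neutral ballI)
  fix j i assume "j \<in> {..<length xs}" "i \<in> {..<j}"
  then have "length (nths xs (- {i, j})) = length xs - 2" "length xs \<ge> 2"
    using length_nths_diff[of "{i, j}" xs] by auto
  then show "(-1) ^ (i + j) * \<alpha> (br (xs ! i) (xs ! j) # nths xs (- {i, j})) = 0"
    using assms by simp
qed

lemma lie_algebra_antisym:
  assumes "lie_algebra br"
  shows "br y x = - br x y"
proof -
  have l: "linear (br u)" "linear (\<lambda>v. br v u)" "br u u = 0" for u
    using assms by (auto simp: lie_algebra_def)
  have "br (x + y) (x + y) = br x x + br x y + br y x + br y y"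
    using l(1,2)[THEN linear_add] by simp
  then show ?thesis by (simp add: l(3) add_eq_0_iff)
qed

text \<open>The case of \<open>d\<^sub>\<hh>\<^sup>2 = 0\<close> that shows \<open>\<psi>\<close> to be closed.  The terms \<open>\<omega>([x\<^sub>i, x\<^sub>j], [x\<^sub>k, x\<^sub>l])\<close> occur
  twice, exchanged, and cancel by antisymmetry; the terms with nested brackets group into the
  Jacobi identity, once for each of the four possible last arguments.\<close>

lemma ce_d_ce_d_2_form:
  assumes "lie_algebra br" and "form 2 \<omega>"
  shows "ce_d br (ce_d br \<omega>) [x, y, z, w] = 0"
proof -
  have jac: "\<omega> [br (br a b) c, t] - \<omega> [br (br a c) b, t] + \<omega> [br (br b c) a, t] = 0" for a b c t
  proof -
    have "br (br a b) c - br (br a c) b + br (br b c) a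
        = - (br a (br b c) + br b (br c a) + br c (br a b))"
      using lie_algebra_antisym[OF assms(1), of "br a b" c] lie_algebra_antisym[OF assms(1), of a "br b c"]
        lie_algebra_antisym[OF assms(1), of b "br a c"]
        lie_algebra_antisym[OF assms(1), of c a] 
        linear_neg[of "br b" "br c a"] assms(1)
      by (simp add: lie_algebra_def)
    also have "\<dots> = 0" using assms(1) by (simp add: lie_algebra_def)
    finally have "\<omega> [br (br a b) c - br (br a c) b + br (br b c) a, t] = 0"
      using linear_0[OF form_2_linear(1)[OF assms(2)]] by simp
    then show ?thesis
      using form_2_linear(1)[OF assms(2), THEN linear_add]
        form_2_linear(1)[OF assms(2), THEN linear_diff] by simp
  qed
  show ?thesis
    unfolding ce_d_3 ce_d_2
    using jac[of x y z w] jac[of x y w z] jac[of x z w y] jac[of y z w x]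
      form_2_antisym[OF assms(2), of "br x y" "br z w"]
      form_2_antisym[OF assms(2), of "br x z" "br y w"]
      form_2_antisym[OF assms(2), of "br x w" "br y z"]
    by linarith
qed

section \<open>Trace-free complex matrices preserve the complex volume form\<close>

text \<open>The derivative of \<open>det (exp (t M) x, exp (t M) y, exp (t M) z) = exp (t trace M) det (x, y, z)\<close>
  at \<open>t = 0\<close>, as a polynomial identity: it is why a trace-free matrix annihilates the complex volume form.\<close>

lemma sum_det_matrix_vector_mult_rows:
  fixes M :: "'a::comm_ring_1^3^3"
  shows "det (vector [M *v x, y, z]) + det (vector [x, M *v y, z]) + det (vector [x, y, M *v z])
    = trace M * det (vector [x, y, z] :: 'a^3^3)"
  by (simp add: det_3 vector_3 matrix_vector_mult_def sum_3 trace_def algebra_simps)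

definition complex_coords :: "(nat \<Rightarrow> 'a::real_vector) \<Rightarrow> 'a \<Rightarrow> complex^3" where
  "complex_coords e x = vector
     [Complex (dual_basis 6 e 1 [x]) (dual_basis 6 e 2 [x]),
      Complex (dual_basis 6 e 3 [x]) (dual_basis 6 e 4 [x]),
      Complex (dual_basis 6 e 5 [x]) (dual_basis 6 e 6 [x])]"

text \<open>The four monomials of \<open>\<psi>\<close> are the real part of
  \<open>(e\<^sup>1 + \<i> e\<^sup>2) \<and> (e\<^sup>3 + \<i> e\<^sup>4) \<and> (e\<^sup>5 + \<i> e\<^sup>6)\<close>.\<close>

lemma SU3_psi_eq_Re_det:
  assumes "SU3_basis \<omega> \<psi> e"
  shows "\<psi> [x, y, z] =
    Re (det (vector [complex_coords e x, complex_coords e y, complex_coords e z] :: complex^3^3))"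
  using assms
  by (simp add: SU3_basis_def monomial_3 monomial_2 complex_coords_def det_3 vector_3 algebra_simps)

lemma dual_basis_has_matrix:
  assumes "is_basis n e" "linear D" "has_matrix n e D M" "i \<in> {1..n}"
  shows "dual_basis n e i [D x] = (\<Sum>j=1..n. M i j * dual_basis n e j [x])"
proof -
  note lin = linear_dual_basis[OF assms(1)]
  have "dual_basis n e i [D (e j)] = M i j" if j: "j \<in> {1..n}" for j
  proof -
    have "dual_basis n e i [D (e j)] = (\<Sum>k=1..n. M k j * dual_basis n e i [e k])"
      using assms(3) j by (simp add: has_matrix_def linear_sum[OF lin] linear_scale[OF lin])
    also have "\<dots> = (\<Sum>k=1..n. if k = i then M k j else 0)"
      by (rule sum.cong) (use dual_basis_delta[OF assms(1,4)] in auto)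
    finally show ?thesis using assms(4) by simp
  qed
  moreover have "dual_basis n e i [D x] = (\<Sum>j=1..n. dual_basis n e j [x] * dual_basis n e i [D (e j)])"
    by (subst is_basis_expand[OF assms(1), of x])
      (simp add: linear_sum[OF assms(2)] linear_scale[OF assms(2)] linear_sum[OF lin] linear_scale[OF lin])
  ultimately show ?thesis by (simp add: mult.commute)
qed

lemma sum_1_6: "(\<Sum>i=1..6::nat. f i) = f 1 + f 2 + f 3 + f 4 + f 5 + (f 6 :: 'a::comm_monoid_add)"
  by (simp add: numeral_eq_Suc ac_simps)

text \<open>The conjugate appears because the blocks of \<open>rho A\<close> carry \<open>Im A\<close> above and \<open>- Im A\<close> below the
  diagonal, opposite to multiplication by \<open>A\<close> in the coordinates \<open>e\<^bsup>2k-1\<^esup> + \<i> e\<^bsup>2k\<^esup>\<close>.\<close>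

lemma complex_coords_rho:
  assumes "is_basis 6 e" "linear D" "has_matrix 6 e D (rho A)"
  shows "complex_coords e (D x) = (\<chi> i j. cnj (A $ i $ j)) *v complex_coords e x"
proof -
  note coord = dual_basis_has_matrix[OF assms, unfolded sum_1_6]
  show ?thesis
    unfolding vec_eq_iff forall_3
    by (simp add: complex_coords_def matrix_vector_mult_def sum_3 coord rho_def complex_eq_iff)
qed

lemma sl3_preserves_psi:
  assumes "SU3_basis \<omega> \<psi> e" "linear D" "has_matrix 6 e D (rho A)" "trace A = 0"
  shows "\<psi> [D x, y, z] + \<psi> [x, D y, z] + \<psi> [x, y, D z] = 0"
proof -
  have "is_basis 6 e" using assms(1) by (simp add: SU3_basis_def)
  note coords = complex_coords_rho[OF this assms(2,3)]
  have "trace (\<chi> i j. cnj (A $ i $ j)) = cnj (trace A)" by (simp add: trace_def)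
  then show ?thesis
    using assms(4)
    unfolding SU3_psi_eq_Re_det[OF assms(1)] coords plus_complex.sel[symmetric]
      sum_det_matrix_vector_mult_rows
    by simp
qed

section \<open>The structure on the extension\<close>

text \<open>In the Jacobi identity for the extended bracket, the terms linear in \<open>\<xi>\<close> vanish because \<open>D\<close> is a
  derivation; those quadratic in \<open>\<xi>\<close> cancel in pairs.\<close>

lemma lie_algebra_ext_bracket:
  assumes "lie_algebra br" "derivation br D"
  shows "lie_algebra (ext_bracket br D)"
proof -
  have br: "linear (br u)" "linear (\<lambda>v. br v u)" "br u u = 0"
      "br u (br v w) + br v (br w u) + br w (br u v) = 0" for u v w
    using assms(1) by (auto simp: lie_algebra_def)
  have D: "linear D" "D (br u v) = br (D u) v + br u (D v)" for u v
    using assms(2) by (auto simp: derivation_def)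
  note lin = linear_add[OF br(1)] linear_add[OF br(2)] linear_scale[OF br(1)] linear_scale[OF br(2)]
    linear_diff[OF br(1)] linear_diff[OF br(2)] linear_add[OF D(1)] linear_diff[OF D(1)]
    linear_scale[OF D(1)]
  have jac: "ext_bracket br D x (ext_bracket br D y z) + ext_bracket br D y (ext_bracket br D z x)
      + ext_bracket br D z (ext_bracket br D x y) = 0" for x y z
    using br(4)[of "fst x" "fst y" "fst z"]
      lie_algebra_antisym[OF assms(1), of "fst x" "D (fst y)"]
      lie_algebra_antisym[OF assms(1), of "fst x" "D (fst z)"]
      lie_algebra_antisym[OF assms(1), of "fst y" "D (fst z)"]
      lie_algebra_antisym[OF assms(1), of "fst y" "D (fst x)"]
      lie_algebra_antisym[OF assms(1), of "fst z" "D (fst y)"]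
      lie_algebra_antisym[OF assms(1), of "fst z" "D (fst x)"]
    by (simp add: ext_bracket_def prod_eq_iff lin D(2) algebra_simps)
  show ?thesis
    unfolding lie_algebra_def
  proof (intro conjI allI)
    show "linear (ext_bracket br D u)" for u
      by (rule linearI) (simp_all add: ext_bracket_def prod_eq_iff lin algebra_simps)
    show "linear (\<lambda>u. ext_bracket br D u v)" for v
      by (rule linearI) (simp_all add: ext_bracket_def prod_eq_iff lin algebra_simps)
    show "ext_bracket br D u u = 0" for u
      by (simp add: ext_bracket_def prod_eq_iff br(3))
  qed (rule jac)
qed

definition G2_form :: "(nat \<Rightarrow> 'a::real_vector) \<Rightarrow> 'a list \<Rightarrow> real" where
  "G2_form e xs = monomial 7 e [1,2,7] xs + monomial 7 e [3,4,7] xs + monomial 7 e [5,6,7] xs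
     + monomial 7 e [1,3,5] xs - monomial 7 e [1,4,6] xs
     - monomial 7 e [2,3,6] xs - monomial 7 e [2,4,5] xs"

lemma G2_form_length: "length xs \<noteq> 3 \<Longrightarrow> G2_form e xs = 0"
  by (simp add: G2_form_def monomial_length)

text \<open>This is \<open>\<psi> + \<omega> \<and> \<eta>\<close>, with \<open>snd\<close> in the role of \<open>\<eta>\<close>.\<close>

lemma G2_form_ext_basis:
  assumes "SU3_basis \<omega> \<psi> e"
  shows "G2_form (ext_basis e) [x, y, z] = \<psi> [fst x, fst y, fst z]
    + snd z * \<omega> [fst x, fst y] - snd y * \<omega> [fst x, fst z] + snd x * \<omega> [fst y, fst z]"
proof -
  have b: "is_basis 6 e" using assms by (simp add: SU3_basis_def)
  show ?thesis
    using assms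
    by (simp add: SU3_basis_def G2_form_def monomial_3 monomial_2 dual_ext_basis[OF b]
        dual_ext_basis_7[OF b] algebra_simps)
qed

lemma G2_structure_ext_basis:
  assumes "SU3_basis \<omega> \<psi> e" "form 2 \<omega>" "form 3 \<psi>"
  shows "G2_structure (G2_form (ext_basis e))"
proof -
  note lin = form_2_linear[OF assms(2), THEN linear_add] form_2_linear[OF assms(2), THEN linear_scale]
    form_3_linear[OF assms(3), THEN linear_add] form_3_linear[OF assms(3), THEN linear_scale]
  have alt: "\<omega> [u, u] = 0" for u using form_2_antisym[OF assms(2), of u u] by simp
  have "form 3 (G2_form (ext_basis e))"
  proof (rule form_3I)
    show "G2_form (ext_basis e) [x, y, x] = 0" for x y
      using form_2_antisym[OF assms(2), of "fst y" "fst x"]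
      by (simp add: G2_form_ext_basis[OF assms(1)] form_3_alternating[OF assms(3)] alt)
  qed (auto intro!: linearI simp: G2_form_length G2_form_ext_basis[OF assms(1)] lin algebra_simps
      form_3_alternating[OF assms(3)] alt)
  moreover have "is_basis 7 (ext_basis e)"
    using assms(1) is_basis_ext_basis by (auto simp: SU3_basis_def)
  ultimately show ?thesis
    unfolding G2_structure_def G2_form_def by blast
qed

text \<open>The identity \<open>d\<phi> = - \<theta> \<and> \<phi>\<close> on four vectors.  Expanded in the \<open>\<xi>\<close>-components \<open>s\<^sub>i\<close> of the arguments,
  \<open>d\<phi>\<close> has \<open>d\<^sub>\<hh>\<psi>\<close> as its constant part, and the coefficients of the \<open>s\<^sub>i\<close> are values of \<open>D\<cdot>\<psi>\<close> and
  \<open>d\<^sub>\<hh>\<omega>\<close>; everything quadratic in the \<open>s\<^sub>i\<close> cancels.  Only the \<open>d\<^sub>\<hh>\<omega> = c \<psi>\<close> part survives, and it is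
  \<open>- \<theta> \<and> \<psi>\<close>.\<close>

lemma ce_d_G2_form:
  assumes lie: "lie_algebra br" and su3: "SU3_basis \<omega> \<psi> e"
    and forms: "form 2 \<omega>" "form 3 \<psi>"
    and c: "c \<noteq> 0" "ce_d br \<omega> = (\<lambda>xs. c * \<psi> xs)"
    and invariant: "\<And>x y z. \<psi> [D x, y, z] + \<psi> [x, D y, z] + \<psi> [x, y, D z] = 0"
    and \<theta>: "\<And>ys. length ys \<noteq> 1 \<Longrightarrow> \<theta> ys = 0" "\<And>x. \<theta> [x] = c * snd x"
  shows "ce_d (ext_bracket br D) (G2_form (ext_basis e)) [X, Y, Z, W]
    = - wedge \<theta> (G2_form (ext_basis e)) [X, Y, Z, W]"
proof -
  have "c * ce_d br \<psi> [x, y, z, w] = ce_d br (\<lambda>xs. c * \<psi> xs) [x, y, z, w]" for x y z w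
    by (simp add: ce_d_3 algebra_simps)
  then have closed: "ce_d br \<psi> [x, y, z, w] = 0" for x y z w
    using ce_d_ce_d_2_form[OF lie forms(1), of x y z w] c
    by (metis mult_eq_0_iff)
  \<comment> \<open>Invariance with the argument \<open>D _\<close> moved to the front, where the differential puts brackets.\<close>
  have inv: "\<psi> [D x, y, z] - \<psi> [D y, x, z] + \<psi> [D z, x, y] = 0" for x y z
    using invariant[of x y z] form_3_antisym_12[OF forms(2), of x "D y" z]
      form_3_antisym_12[OF forms(2), of x "D z" y] form_3_antisym_23[OF forms(2), of x y "D z"]
    by simp
  note lin = form_2_linear(1)[OF forms(1), THEN linear_add] form_2_linear(1)[OF forms(1), THEN linear_diff]
    form_2_linear(1)[OF forms(1), THEN linear_scale]
    form_3_linear(1)[OF forms(2), THEN linear_add] form_3_linear(1)[OF forms(2), THEN linear_diff]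
    form_3_linear(1)[OF forms(2), THEN linear_scale]
  obtain x1 s1 x2 s2 x3 s3 x4 s4 where X: "X = (x1, s1)" "Y = (x2, s2)" "Z = (x3, s3)" "W = (x4, s4)"
    by (metis surj_pair)
  have "ce_d (ext_bracket br D) (G2_form (ext_basis e)) [X, Y, Z, W] =
      ce_d br \<psi> [x1, x2, x3, x4]
      - s1 * (\<psi> [D x2, x3, x4] - \<psi> [D x3, x2, x4] + \<psi> [D x4, x2, x3])
      + s2 * (\<psi> [D x1, x3, x4] - \<psi> [D x3, x1, x4] + \<psi> [D x4, x1, x3])
      - s3 * (\<psi> [D x1, x2, x4] - \<psi> [D x2, x1, x4] + \<psi> [D x4, x1, x2])
      + s4 * (\<psi> [D x1, x2, x3] - \<psi> [D x2, x1, x3] + \<psi> [D x3, x1, x2])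
      - s1 * ce_d br \<omega> [x2, x3, x4] + s2 * ce_d br \<omega> [x1, x3, x4]
      - s3 * ce_d br \<omega> [x1, x2, x4] + s4 * ce_d br \<omega> [x1, x2, x3]"
    by (simp add: X ce_d_3 ce_d_2 G2_form_ext_basis[OF su3] ext_bracket_def lin algebra_simps)
  also have "\<dots> = - wedge \<theta> (G2_form (ext_basis e)) [X, Y, Z, W]"
    unfolding closed inv c(2)
    by (simp add: X wedge_one_form_4 \<theta> G2_form_ext_basis[OF su3] algebra_simps)
  finally show ?thesis .
qed

theorem proposition5p1:
  fixes br :: "'a::real_vector \<Rightarrow> 'a \<Rightarrow> 'a"
    and D :: "'a \<Rightarrow> 'a"
    and \<omega> \<psi> :: "'a list \<Rightarrow> real"
    and e :: "nat \<Rightarrow> 'a"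
    and A :: "complex^3^3"
  assumes "lie_algebra br"
    and "dim (UNIV :: 'a set) = 6"
    and "coupled br \<omega> \<psi>"
    and "derivation br D"
    and "SU3_basis \<omega> \<psi> e"
    and "trace A = 0"
    and "has_matrix 6 e D (rho A)"
  shows "lie_algebra (ext_bracket br D) \<and>
    (\<exists>\<phi>. G2_structure \<phi> \<and> loc_conf_calibrated (ext_bracket br D) \<phi>)"
proof (intro conjI exI)
  let ?\<phi> = "G2_form (ext_basis e)"
  have forms: "form 2 \<omega>" "form 3 \<psi>"
    using assms(3) by (auto simp: coupled_def SU3_structure_def)
  obtain c where c: "c \<noteq> 0" "ce_d br \<omega> = (\<lambda>xs. c * \<psi> xs)"
    using assms(3) by (auto simp: coupled_def)
  have "linear D" using assms(4) by (simp add: derivation_def)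
  note invariant = sl3_preserves_psi[OF assms(5) this assms(7,6)]
  define \<theta> :: "('a \<times> real) list \<Rightarrow> real"
    where "\<theta> xs = (case xs of [x] \<Rightarrow> c * snd x | _ \<Rightarrow> 0)" for xs
  have \<theta>: "\<And>ys. length ys \<noteq> 1 \<Longrightarrow> \<theta> ys = 0" "\<And>x. \<theta> [x] = c * snd x"
    by (auto simp: \<theta>_def split: list.split)
  show "lie_algebra (ext_bracket br D)"
    using assms(1,4) by (rule lie_algebra_ext_bracket)
  show "G2_structure ?\<phi>"
    using assms(5) forms by (rule G2_structure_ext_basis)
  show "loc_conf_calibrated (ext_bracket br D) ?\<phi>"
    unfolding loc_conf_calibrated_def
  proof (intro exI conjI ext)
    show "form 1 \<theta>"
      unfolding form_def
      by (auto simp: \<theta> length_Suc_conv algebra_simps intro!: linearI)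
    show "ce_d (ext_bracket br D) \<theta> xs = 0" for xs
    proof (cases "length xs = 2")
      case True
      then obtain x y where "xs = [x, y]"
        by (auto simp: numeral_2_eq_2 length_Suc_conv)
      then show ?thesis by (simp add: ce_d_1 \<theta> ext_bracket_def)
    next
      case False
      then show ?thesis using ce_d_length[of 1 \<theta> xs] \<theta>(1) by simp
    qed
    show "ce_d (ext_bracket br D) ?\<phi> xs = - wedge \<theta> ?\<phi> xs" for xs
    proof (cases "length xs = 4")
      case True
      then obtain x y z w where "xs = [x, y, z, w]"
        by (auto simp: numeral_eq_Suc length_Suc_conv)
      then show ?thesis
        using ce_d_G2_form[OF assms(1,5) forms c invariant \<theta>] by simp
    next
      case False
      then show ?thesis
        using ce_d_length[of 3 ?\<phi> xs] wedge_length_one_left[of \<theta> 3 ?\<phi> xs]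
        by (simp add: G2_form_length \<theta>(1))
    qed
  qed
qed

end
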